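(* Let $m\le n$ be positive integers, let $\mathbf A$ be a real $m\times n$ matrix and let $q\in(0,1]$. There exist positive constants $C_0,C_1,C_2,C_3$, independent of $\epsilon$, $\mathbf x$ and $s$, such that the following holds. Let $s$ be an integer with $2\le2s\le m$ such that $\delta_{2s}(\mathbf A)\in(0,1)$ and such that $$a(q,\delta_1)<\delta_1,\qquad\text{where}\quad \delta_1:=\Big(\frac{1-\delta_{2s}(\mathbf A)}{1+\delta_{2s}(\mathbf A)}\Big)^{1/2}.$$ Let $\epsilon\ge0$, let $\mathbf x\in\mathbb R^n$, let $\mathbf z\in\mathbb R^m$ with $\|\mathbf z\|_2\le\epsilon$, put $\mathbf y=\mathbf A\mathbf x+\mathbf z$, and let $\mathbf x^*$ be a solution of the $\ell^q$-minimization problem $$\min_{\tilde{\mathbf x}\in\mathbb R^n}\|\tilde{\mathbf x}\|_q\quad\text{subject to}\quad\|\mathbf A\tilde{\mathbf x}-\mathbf y\|_2\le\epsilon .$$ Let $\mathbf x_s$ be a best $s$-sparse approximation of $\mathbf x$, i.e. $\mathbf x_s\in\Sigma_s$ and $\|\mathbf x_s-\mathbf x\|_q=\inf_{\mathbf x'\in\Sigma_s}\|\mathbf x'-\mathbf x\|_q$. Then $$\|\mathbf x^*-\mathbf x\|_2\le C_0\,s^{1/2-1/q}\,\|\mathbf x-\mathbf x_s\|_q+C_1\epsilon$$ and $$\|\mathbf x^*-\mathbf x\|_q\le C_2\,\|\mathbf x-\mathbf x_s\|_q+C_3\,s^{1/q-1/2}\,\epsilon .$$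
   Context: For $\mathbf x=(x_1,\dots,x_n)^T\in\mathbb R^n$ and $0<q<\infty$, $\|\mathbf x\|_q=(|x_1|^q+\cdots+|x_n|^q)^{1/q}$. $\Sigma_k$ is the set of vectors in $\mathbb R^n$ with at most $k$ nonzero components. The restricted isometry constant $\delta_k(\mathbf A)$ of order $k$ is the smallest $\delta\ge0$ such that $(1-\delta)\|\mathbf x\|_2^2\le\|\mathbf A\mathbf x\|_2^2\le(1+\delta)\|\mathbf x\|_2^2$ for all $\mathbf x\in\Sigma_k$. For $0<q\le1$ and $\delta\in(0,1)$, $$a(q,\delta):=\inf_{0<r_0<1}\max\Big\{\frac{1+r_0\delta}{(1+r_0^q\delta^q)^{1/q}},\ \sup_{\sqrt2(1-r_0)\delta/2\le y\le1}\frac{2y}{(1+2^{-q/2}y^{2+q})^{1/q}},\ \sup_{\sqrt2(1-r_0)\delta/2\le y\le1}\frac{3y}{(1+y)^{1/q}},\ \sup_{y\ge1}\frac{2y}{(1+y)^{1/q}}\Big\}.$$ *)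

theory Defs
  imports "HOL-Analysis.Analysis"
begin

text \<open>
  For \<open>0 < q\<close>; the case \<open>q = 2\<close> is the library's \<^const>\<open>norm\<close> on \<^typ>\<open>real ^ 'n\<close>.
\<close>

definition lq_norm :: "real \<Rightarrow> real ^ 'n \<Rightarrow> real" where
  "lq_norm q x = (\<Sum>i\<in>UNIV. \<bar>x $ i\<bar> powr q) powr (1 / q)"

lemma lq_norm_2: "lq_norm 2 x = norm x"
  by (simp add: lq_norm_def norm_vec_def L2_set_def powr_half_sqrt sum_nonneg)

definition sparse :: "nat \<Rightarrow> (real ^ 'n) set" where
  "sparse k = {x. card {i. x $ i \<noteq> 0} \<le> k}"

definition rip_bound :: "real ^ 'n ^ 'm \<Rightarrow> nat \<Rightarrow> real \<Rightarrow> bool" where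
  "rip_bound A k \<delta> \<longleftrightarrow> 0 \<le> \<delta> \<and>
     (\<forall>x\<in>sparse k. (1 - \<delta>) * (norm x)\<^sup>2 \<le> (norm (A *v x))\<^sup>2 \<and>
                    (norm (A *v x))\<^sup>2 \<le> (1 + \<delta>) * (norm x)\<^sup>2)"

text \<open>The least element exists for every matrix and every order: see \<open>rip_bound_ric\<close> below.\<close>

definition ric :: "real ^ 'n ^ 'm \<Rightarrow> nat \<Rightarrow> real" where
  "ric A k = (LEAST \<delta>. rip_bound A k \<delta>)"

lemma rip_bound_least_exists:
  "\<exists>\<delta>. rip_bound A k \<delta> \<and> (\<forall>\<delta>'. rip_bound A k \<delta>' \<longrightarrow> \<delta> \<le> \<delta>')"
proof -
  let ?S = "{\<delta>. rip_bound A k \<delta>}"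
  obtain K where K: "\<And>x. norm (A *v x) \<le> norm x * K"
    using bounded_linear.bounded[OF matrix_vector_mul_bounded_linear[of A]] by blast
  have "rip_bound A k (1 + K\<^sup>2)"
    unfolding rip_bound_def
  proof (intro conjI ballI)
    fix x :: "real ^ 'a"
    have "(norm (A *v x))\<^sup>2 \<le> (norm x * K)\<^sup>2"
      using K[of x] by (intro power_mono) auto
    then show "(norm (A *v x))\<^sup>2 \<le> (1 + (1 + K\<^sup>2)) * (norm x)\<^sup>2"
      by (simp add: power_mult_distrib algebra_simps add_increasing)
    have "(1 - (1 + K\<^sup>2)) * (norm x)\<^sup>2 \<le> 0" by simp
    then show "(1 - (1 + K\<^sup>2)) * (norm x)\<^sup>2 \<le> (norm (A *v x))\<^sup>2"
      using zero_le_power2[of "norm (A *v x)"] by linarith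
  qed simp
  then have ne: "?S \<noteq> {}" by blast
  have bdd: "bdd_below ?S"
    by (rule bdd_belowI[of _ 0]) (simp add: rip_bound_def)
  define T where "T = {0..} \<inter>
      (\<Inter>x\<in>sparse k. {\<delta>. (1 - \<delta>) * (norm x)\<^sup>2 \<le> (norm (A *v x))\<^sup>2} \<inter>
                     {\<delta>. (norm (A *v x))\<^sup>2 \<le> (1 + \<delta>) * (norm x)\<^sup>2})"
  have S: "?S = T"
    by (auto simp: rip_bound_def T_def)
  have "closed T"
    unfolding T_def
    by (intro closed_Int closed_INT ballI closed_Collect_le continuous_intros)
  then have mem: "Inf T \<in> T"
    using ne bdd unfolding S by (intro closed_contains_Inf)
  have le: "Inf T \<le> \<delta>'" if "rip_bound A k \<delta>'" for \<delta>'
    using that S bdd by (intro cInf_lower) auto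
  have "rip_bound A k (Inf T)"
    using mem S by blast
  with le show ?thesis by blast
qed

lemma rip_bound_ric: "rip_bound A k (ric A k)"
  and ric_le: "rip_bound A k \<delta> \<Longrightarrow> ric A k \<le> \<delta>"
proof -
  obtain d where d: "rip_bound A k d" "\<And>\<delta>'. rip_bound A k \<delta>' \<Longrightarrow> d \<le> \<delta>'"
    using rip_bound_least_exists by blast
  then have "ric A k = d"
    unfolding ric_def by (intro Least_equality)
  with d show "rip_bound A k (ric A k)" and "rip_bound A k \<delta> \<Longrightarrow> ric A k \<le> \<delta>"
    by auto
qed

text \<open>
  For \<open>0 < q \<le> 1\<close> and \<open>0 < \<delta> < 1\<close> all suprema below are over nonempty sets bounded above
  (on \<open>y \<ge> 1\<close> because \<open>1 / q \<ge> 1\<close>), and the infimum is over a set bounded below by \<open>0\<close>,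
  so the total operators on the reals take their intended values.
\<close>

definition a_const :: "real \<Rightarrow> real \<Rightarrow> real" where
  "a_const q \<delta> =
     (INF r\<in>{0<..<1}. Max {
        (1 + r * \<delta>) / (1 + r powr q * \<delta> powr q) powr (1 / q),
        (SUP y\<in>{sqrt 2 * (1 - r) * \<delta> / 2..1}.
           2 * y / (1 + 2 powr (- q / 2) * y powr (2 + q)) powr (1 / q)),
        (SUP y\<in>{sqrt 2 * (1 - r) * \<delta> / 2..1}. 3 * y / (1 + y) powr (1 / q)),
        (SUP y\<in>{1..}. 2 * y / (1 + y) powr (1 / q))})"

definition lq_minimizer ::
  "real \<Rightarrow> real ^ 'n ^ 'm \<Rightarrow> real ^ 'm \<Rightarrow> real \<Rightarrow> real ^ 'n \<Rightarrow> bool" where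
  "lq_minimizer q A y \<epsilon> u \<longleftrightarrow> is_arg_min (lq_norm q) (\<lambda>v. norm (A *v v - y) \<le> \<epsilon>) u"

definition best_sparse_approx :: "real \<Rightarrow> nat \<Rightarrow> real ^ 'n \<Rightarrow> real ^ 'n \<Rightarrow> bool" where
  "best_sparse_approx q s x xs \<longleftrightarrow>
     xs \<in> sparse s \<and> lq_norm q (xs - x) = (INF x'\<in>sparse s. lq_norm q (x' - x))"

end

theory Submission
  imports Defs
begin

text \<open>
  The constants may depend on \<open>A\<close>, so it suffices that
  \<open>\<parallel>h\<^sub>S\<parallel>\<^sub>q < \<parallel>h\<^bsub>-S\<^esub>\<parallel>\<^sub>q\<close> for all nonzero \<open>h\<close> in the kernel of \<open>A\<close> and all \<open>S\<close> with
  at most \<open>s\<close> elements: compactness of the unit sphere of the kernel makes this gap quantitative, a linear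
  right inverse of \<open>A\<close> extends it to all \<open>h\<close>, and \<open>s \<le> m\<close> bounds the powers of \<open>s\<close>.

  If the strict inequality fails for some \<open>h\<close>, arrange \<open>\<bar>h\<bar>\<close> decreasingly into blocks
  \<open>0, 1, 2, \<dots>\<close> of length \<open>s\<close>, scaled so that the first entry of block \<open>2\<close> is \<open>1\<close>. With
  \<open>s y\<close> the sum of the \<open>q\<close>-th powers over blocks \<open>2, 3, \<dots>\<close>, the sum \<open>T\<close> of the Euclidean norms of
  these blocks is at most \<open>sqrt s * (sqrt y + y)\<close>. The restricted isometry property bounds \<open>T\<close> from
  below by \<open>\<delta>\<^sub>1\<close> times the norm of blocks \<open>0\<close> and \<open>1\<close>, which is at least
  \<open>sqrt s * (1 + y) powr (1 / q)\<close> and at least \<open>sqrt (2 * s)\<close>. For \<open>y \<ge> 1\<close> the fourth entry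
  of the maximum defining \<open>a(q, \<delta>\<^sub>1)\<close> is therefore at least \<open>\<delta>\<^sub>1\<close>, and for \<open>y < 1\<close> the second one
  is, evaluated at \<open>sqrt y\<close>.
\<close>

section \<open>Lower bounds for \<open>a_const\<close>\<close>

lemma one_plus_powr_ge:
  fixes q y :: real
  assumes "0 < q" "q \<le> 1" "0 \<le> y"
  shows "1 + y \<le> (1 + y) powr (1 / q)"
  using powr_mono[of 1 "1 / q" "1 + y"] assms by simp

text \<open>The fourth entry of the maximum does not depend on \<open>r\<close>, so one point
  \<open>y\<close> with value at least \<open>d\<close> bounds every maximum, hence the infimum,
  from below.\<close>

lemma le_a_const_large:
  fixes q d y :: real
  assumes q: "0 < q" "q \<le> 1" and y: "1 \<le> y"
    and d: "d \<le> 2 * y / (1 + y) powr (1 / q)"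
  shows "d \<le> a_const q d"
  unfolding a_const_def
proof (rule cINF_greatest)
  fix r :: real assume "r \<in> {0<..<1}"
  let ?f = "\<lambda>y::real. 2 * y / (1 + y) powr (1 / q)"
  have "bdd_above (?f ` {1..})"
  proof (rule bdd_aboveI2)
    fix y :: real assume "y \<in> {1..}"
    then show "?f y \<le> 2"
      using one_plus_powr_ge[OF q, of y] by (simp add: divide_le_eq)
  qed
  then have "?f y \<le> (SUP y\<in>{1..}. ?f y)"
    using y by (intro cSUP_upper) auto
  with d have "d \<le> (SUP y\<in>{1..}. ?f y)" by linarith
  then show "d \<le> Max {
        (1 + r * d) / (1 + r powr q * d powr q) powr (1 / q),
        (SUP y\<in>{sqrt 2 * (1 - r) * d / 2..1}.
           2 * y / (1 + 2 powr (- q / 2) * y powr (2 + q)) powr (1 / q)),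
        (SUP y\<in>{sqrt 2 * (1 - r) * d / 2..1}. 3 * y / (1 + y) powr (1 / q)),
        (SUP y\<in>{1..}. 2 * y / (1 + y) powr (1 / q))}"
    by (subst Max_ge_iff) auto
qed auto

text \<open>For every \<open>r\<close> the left end of the interval in the second entry is at most
  \<open>sqrt 2 * d / 2\<close>, so \<open>w\<close> is admissible for all \<open>r\<close> at once.
  As \<open>w \<le> 1\<close>, the term \<open>2 powr (- q / 2) * w powr (2 + q)\<close> is at most
  \<open>w\<^sup>2\<close>, so the assumed bound carries over to the second entry at
  \<open>w\<close>.\<close>

lemma le_a_const_small:
  fixes q d w :: real
  assumes q: "0 < q" "q \<le> 1" and d0: "0 \<le> d" and w: "sqrt 2 * d / 2 \<le> w" "w \<le> 1"
    and d: "d \<le> 2 * w / (1 + w\<^sup>2) powr (1 / q)"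
  shows "d \<le> a_const q d"
  unfolding a_const_def
proof (rule cINF_greatest)
  fix r :: real assume r: "r \<in> {0<..<1}"
  let ?g = "\<lambda>y::real. 2 * y / (1 + 2 powr (- q / 2) * y powr (2 + q)) powr (1 / q)"
  let ?I = "{sqrt 2 * (1 - r) * d / 2..1}"
  have ge1: "1 \<le> (1 + 2 powr (- q / 2) * y powr (2 + q)) powr (1 / q)" for y :: real
    using q by (intro ge_one_powr_ge_zero) auto
  have bdd: "bdd_above (?g ` ?I)"
  proof (rule bdd_aboveI2)
    fix y :: real assume "y \<in> ?I"
    then show "?g y \<le> 2"
      using ge1[of y] by (simp add: divide_le_eq)
  qed
  have le: "sqrt 2 * (1 - r) * d / 2 \<le> sqrt 2 * d / 2"
    using r d0 by (intro divide_right_mono mult_right_mono mult_left_le) auto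
  have "w \<in> ?I"
    unfolding atLeastAtMost_iff using order.trans[OF le w(1)] w(2) by blast
  then have "?g w \<le> (SUP y\<in>?I. ?g y)"
    by (rule cSUP_upper[OF _ bdd])
  moreover have "d \<le> ?g w"
  proof -
    have "0 \<le> sqrt 2 * d / 2" using d0 by simp
    then have w0: "0 \<le> w" using w(1) by linarith
    have "2 powr (- q / 2) * w powr (2 + q) \<le> 1 * w powr 2"
      using q w w0 by (intro mult_mono powr_mono')
        (auto simp: powr_minus inverse_le_1_iff ge_one_powr_ge_zero)
    then have "(1 + 2 powr (- q / 2) * w powr (2 + q)) powr (1 / q) \<le> (1 + w\<^sup>2) powr (1 / q)"
      using q w0 by (intro powr_mono2) auto
    then have "2 * w / (1 + w\<^sup>2) powr (1 / q) \<le> ?g w"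
      using ge1[of w] w0 by (intro divide_left_mono mult_pos_pos) auto
    with d show ?thesis by linarith
  qed
  ultimately have "d \<le> (SUP y\<in>?I. ?g y)" by linarith
  then show "d \<le> Max {
        (1 + r * d) / (1 + r powr q * d powr q) powr (1 / q),
        (SUP y\<in>?I. ?g y),
        (SUP y\<in>?I. 3 * y / (1 + y) powr (1 / q)),
        (SUP y\<in>{1..}. 2 * y / (1 + y) powr (1 / q))}"
    by (subst Max_ge_iff) auto
qed auto

section \<open>Block sums of a decreasing sequence\<close>

text \<open>Jensen's inequality for the convex function \<open>t powr (2 / q)\<close>, at the points
  \<open>a i powr q\<close> with equal weights.\<close>

lemma power_mean_le_quadratic_mean:
  fixes a :: "'a \<Rightarrow> real" and q :: real
  assumes I: "finite I" "I \<noteq> {}" and pos: "\<And>i. i \<in> I \<Longrightarrow> 0 < a i" and q: "0 < q" "q \<le> 2"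
  shows "((\<Sum>i\<in>I. a i powr q) / card I) powr (1 / q) \<le> sqrt ((\<Sum>i\<in>I. (a i)\<^sup>2) / card I)"
proof -
  define u where "u = (\<Sum>i\<in>I. a i powr q) / card I"
  have c: "0 < real (card I)" using I by (simp add: card_gt_0_iff)
  have u: "0 \<le> u" by (simp add: u_def sum_nonneg)
  have "(\<Sum>i\<in>I. (1 / card I) *\<^sub>R (a i powr q)) powr (2 / q)
      \<le> (\<Sum>i\<in>I. (1 / card I) * (a i powr q) powr (2 / q))"
    using I c q pos by (intro convex_on_sum[OF _ _ powr_convex]) (auto simp: less_imp_neq[THEN not_sym])
  also have "\<dots> = (\<Sum>i\<in>I. (a i)\<^sup>2) / card I"
    unfolding sum_divide_distrib using q pos by (intro sum.cong) (auto simp: powr_powr less_imp_le)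
  finally have "u powr (2 / q) \<le> (\<Sum>i\<in>I. (a i)\<^sup>2) / card I"
    by (simp add: u_def sum_divide_distrib)
  moreover have "u powr (2 / q) = (u powr (1 / q))\<^sup>2"
    using powr_powr[of u "1 / q" 2] by (simp add: powr_numeral)
  ultimately show ?thesis
    unfolding u_def by (metis real_le_rsqrt)
qed

text \<open>From block 2 on all entries are at most 1. In block 2, squares are thus bounded by
  \<open>q\<close>-th powers, which gives the square root term. In a later block every entry is at
  most the first one, and this is at most the average of the \<open>q\<close>-th powers over the
  preceding block, which gives the linear term.\<close>

lemma block_tail_le:
  fixes a :: "nat \<Rightarrow> real" and q :: real
  assumes q: "0 < q" "q \<le> 1" and s: "0 < s" and anti: "antimono a" and nn: "\<And>i. 0 \<le> a i"
    and le1: "a (2 * s) \<le> 1"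
  shows "(\<Sum>k=2..<K. sqrt (\<Sum>i=k * s..<k * s + s. (a i)\<^sup>2))
     \<le> sqrt s * (sqrt ((\<Sum>k=2..<K. \<Sum>i=k * s..<k * s + s. a i powr q) / s)
                + (\<Sum>k=2..<K. \<Sum>i=k * s..<k * s + s. a i powr q) / s)"
    (is "?T \<le> _")
proof (cases "K \<le> 2")
  case True
  then show ?thesis by simp
next
  case False
  define U where "U k = (\<Sum>i=k * s..<k * s + s. a i powr q)" for k
  define Y where "Y = (\<Sum>k=2..<K. U k)"
  have U0: "0 \<le> U k" for k by (simp add: U_def sum_nonneg)
  have a1: "a i \<le> 1" if "2 * s \<le> i" for i
    using antimonoD[OF anti that] le1 by linarith
  have first: "sqrt (\<Sum>i=2 * s..<2 * s + s. (a i)\<^sup>2) \<le> sqrt Y"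
  proof (rule real_sqrt_le_mono)
    have "(\<Sum>i=2 * s..<2 * s + s. (a i)\<^sup>2) \<le> U 2"
      unfolding U_def
    proof (rule sum_mono)
      fix i assume "i \<in> {2 * s..<2 * s + s}"
      then show "(a i)\<^sup>2 \<le> a i powr q"
        using powr_mono'[of q 2 "a i"] q a1[of i] nn[of i] by simp
    qed
    also have "\<dots> \<le> Y"
      unfolding Y_def using False U0 by (intro member_le_sum) auto
    finally show "(\<Sum>i=2 * s..<2 * s + s. (a i)\<^sup>2) \<le> Y" .
  qed
  have step: "sqrt (\<Sum>i=Suc k * s..<Suc k * s + s. (a i)\<^sup>2) \<le> sqrt s * (U k / s)" if "2 \<le> k" for k
  proof -
    let ?b = "a (Suc k * s)"
    have b1: "?b \<le> 1" using that by (intro a1) simp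
    have "(\<Sum>i=Suc k * s..<Suc k * s + s. (a i)\<^sup>2) \<le> (\<Sum>i=Suc k * s..<Suc k * s + s. ?b\<^sup>2)"
      using nn anti by (intro sum_mono power_mono) (auto dest: antimonoD)
    then have "sqrt (\<Sum>i=Suc k * s..<Suc k * s + s. (a i)\<^sup>2) \<le> sqrt (s * ?b\<^sup>2)"
      by simp
    also have "\<dots> = sqrt s * ?b" using nn by (simp add: real_sqrt_mult)
    also have "?b \<le> U k / s"
    proof -
      have "real s * ?b \<le> real s * ?b powr q"
        using powr_mono'[of q 1 "?b"] q b1 nn[of "Suc k * s"] by (intro mult_left_mono) auto
      also have "\<dots> = (\<Sum>i=k * s..<k * s + s. ?b powr q)" by simp
      also have "\<dots> \<le> U k"
        unfolding U_def using q nn by (intro sum_mono powr_mono2 antimonoD[OF anti]) auto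
      finally show ?thesis using s by (simp add: field_simps)
    qed
    finally show ?thesis by (simp add: mult_left_mono)
  qed
  have "?T = sqrt (\<Sum>i=2 * s..<2 * s + s. (a i)\<^sup>2) + (\<Sum>k=Suc 2..<K. sqrt (\<Sum>i=k * s..<k * s + s. (a i)\<^sup>2))"
    using False by (simp add: sum.atLeast_Suc_lessThan)
  also have "(\<Sum>k=Suc 2..<K. sqrt (\<Sum>i=k * s..<k * s + s. (a i)\<^sup>2))
      = (\<Sum>k=2..<K - 1. sqrt (\<Sum>i=Suc k * s..<Suc k * s + s. (a i)\<^sup>2))"
    using False sum.shift_bounds_Suc_ivl[of "\<lambda>k. sqrt (\<Sum>i=k * s..<k * s + s. (a i)\<^sup>2)" 2 "K - 1"] by simp
  also have "\<dots> \<le> (\<Sum>k=2..<K - 1. sqrt s * (U k / s))"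
    by (intro sum_mono step) auto
  \<comment> \<open>The last block bounds no later one; its nonnegative sum is added so that all of
    \<open>Y\<close> appears.\<close>
  also have "\<dots> \<le> (\<Sum>k=2..<K. sqrt s * (U k / s))"
    using U0 by (intro sum_mono2) auto
  also have "\<dots> = sqrt s * (Y / s)"
    by (simp add: Y_def sum_divide_distrib sum_distrib_left)
  also have "sqrt (\<Sum>i=2 * s..<2 * s + s. (a i)\<^sup>2) \<le> sqrt s * sqrt (Y / s)"
    using first s by (simp add: real_sqrt_divide)
  finally show ?thesis
    by (simp add: Y_def U_def algebra_simps)
qed

lemma sum_blocks:
  fixes f :: "nat \<Rightarrow> 'a::ab_group_add"
  assumes "j \<le> K"
  shows "(\<Sum>k=j..<K. \<Sum>i=k * s..<k * s + s. f i) = (\<Sum>i=j * s..<K * s. f i)"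
  using assms
proof (induction K rule: dec_induct)
  case (step K)
  then have "j * s \<le> K * s" by simp
  then show ?case
    using step sum.atLeastLessThan_concat[of "j * s" "K * s" "K * s + s" f] by (simp add: add.commute)
qed simp

text \<open>Block 1 contributes at least \<open>s\<close>, so by \<open>head\<close> the sum over
  block 0 is at least \<open>s * (1 + y)\<close>. The power mean inequality turns this into a bound
  on the Euclidean norm, and \<open>tail\<close> yields
  \<open>d * (1 + y) powr (1 / q) \<le> sqrt y + y\<close>. Replacing the smaller term on the right
  by the larger one leads to one of the two bounds for \<open>a_const\<close>.\<close>

lemma block_inequality_normalized:
  fixes a :: "nat \<Rightarrow> real" and q d :: real
  assumes q: "0 < q" "q \<le> 1" and d: "0 < d" and s: "0 < s" and K: "2 \<le> K"
    and anti: "antimono a" and nn: "\<And>i. 0 \<le> a i" and one: "a (2 * s) = 1"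
    and head: "(\<Sum>i=s..<K * s. a i powr q) \<le> (\<Sum>i<s. a i powr q)"
    and tail: "d * sqrt (\<Sum>i<2 * s. (a i)\<^sup>2) \<le> (\<Sum>k=2..<K. sqrt (\<Sum>i=k * s..<k * s + s. (a i)\<^sup>2))"
  shows "d \<le> a_const q d"
proof -
  define Y where "Y = (\<Sum>i=2 * s..<K * s. a i powr q)"
  define y where "y = Y / s"
  have s0: "0 < real s" using s by simp
  have y0: "0 \<le> y" by (simp add: y_def Y_def sum_nonneg)
  have ge1: "1 \<le> a i" if "i \<le> 2 * s" for i
    using antimonoD[OF anti that] one by simp
  have up: "d * sqrt (\<Sum>i<2 * s. (a i)\<^sup>2) \<le> sqrt s * (sqrt y + y)"
    using tail block_tail_le[OF q s anti nn, of K] one sum_blocks[OF K, where s=s and f="\<lambda>i. a i powr q"]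
    by (simp add: y_def Y_def)
  have "s * (1 + y) = (\<Sum>i=s..<2 * s. 1) + Y"
    using s by (simp add: y_def field_simps)
  also have "\<dots> \<le> (\<Sum>i=s..<2 * s. a i powr q) + Y"
    using q ge1 by (intro add_mono sum_mono) (auto intro!: ge_one_powr_ge_zero)
  also have "\<dots> = (\<Sum>i=s..<K * s. a i powr q)"
    unfolding Y_def using K by (intro sum.atLeastLessThan_concat) auto
  finally have "1 + y \<le> (\<Sum>i<s. a i powr q) / s"
    using head s0 by (simp add: field_simps)
  then have "(1 + y) powr (1 / q) \<le> ((\<Sum>i<s. a i powr q) / s) powr (1 / q)"
    using q y0 by (intro powr_mono2) auto
  also have "\<dots> \<le> sqrt ((\<Sum>i<s. (a i)\<^sup>2) / s)"
  proof -
    have "0 < a i" if "i < s" for i using ge1[of i] that by simp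
    then show ?thesis
      using power_mean_le_quadratic_mean[of "{..<s}" a q] q s by auto
  qed
  also have "\<dots> \<le> sqrt ((\<Sum>i<2 * s. (a i)\<^sup>2) / s)"
    by (intro real_sqrt_le_mono divide_right_mono sum_mono2) auto
  finally have "d * ((1 + y) powr (1 / q) * sqrt s) \<le> d * sqrt (\<Sum>i<2 * s. (a i)\<^sup>2)"
    using d s0 by (intro mult_left_mono) (auto simp: real_sqrt_divide field_simps)
  with up have "sqrt s * (d * (1 + y) powr (1 / q)) \<le> sqrt s * (sqrt y + y)"
    by (simp add: algebra_simps)
  then have main: "d * (1 + y) powr (1 / q) \<le> sqrt y + y"
    using s0 by simp
  have P: "0 < (1 + y) powr (1 / q)" using y0 by simp
  show ?thesis
  proof (cases "1 \<le> y")
    case True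
    then have "sqrt y \<le> y" by (simp add: real_le_lsqrt power2_eq_square mult_left_le)
    with main have "d \<le> 2 * y / (1 + y) powr (1 / q)"
      using P by (simp add: le_divide_eq)
    then show ?thesis by (rule le_a_const_large[OF q True])
  next
    case False
    have yy: "y = (sqrt y)\<^sup>2" using y0 by simp
    have "y \<le> sqrt y"
      using False y0 by (intro real_le_rsqrt) (simp add: power2_eq_square mult_left_le)
    \<comment> \<open>That the first \<open>2 * s\<close> entries are at least 1 yields
      \<open>sqrt 2 * d / 2 \<le> sqrt y\<close>, the condition on the evaluation point
      \<open>sqrt y\<close>.\<close>
    have "d * (sqrt 2 * sqrt s) \<le> d * sqrt (\<Sum>i<2 * s. (a i)\<^sup>2)"
    proof -
      have "2 * real s = (\<Sum>i<2 * s. 1)" by simp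
      also have "\<dots> \<le> (\<Sum>i<2 * s. (a i)\<^sup>2)"
        using ge1 by (intro sum_mono) (auto simp: one_le_power)
      finally show ?thesis
        using d by (simp flip: real_sqrt_mult)
    qed
    also have "\<dots> \<le> sqrt s * (2 * sqrt y)"
      using up \<open>y \<le> sqrt y\<close> s0 by (smt (verit) mult_left_mono real_sqrt_ge_zero)
    finally have "sqrt s * (d * sqrt 2) \<le> sqrt s * (2 * sqrt y)"
      by (simp add: algebra_simps)
    then have "sqrt 2 * d / 2 \<le> sqrt y"
      using s0 by (simp add: mult.commute)
    moreover have "d \<le> 2 * sqrt y / (1 + (sqrt y)\<^sup>2) powr (1 / q)"
      using main P \<open>y \<le> sqrt y\<close> y0 by (simp add: le_divide_eq)
    ultimately show ?thesis
      using False d by (intro le_a_const_small[OF q]) auto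
  qed
qed

text \<open>Both inequalities are homogeneous, so it is enough to divide by
  \<open>a (2 * s)\<close>. If this entry were zero, the right side of \<open>tail\<close> would
  vanish while the left side is positive because of \<open>a 0\<close>.\<close>

lemma block_inequality:
  fixes a :: "nat \<Rightarrow> real" and q d :: real
  assumes q: "0 < q" "q \<le> 1" and d: "0 < d" and s: "0 < s" and K: "2 \<le> K"
    and anti: "antimono a" and nn: "\<And>i. 0 \<le> a i" and pos: "0 < a 0"
    and head: "(\<Sum>i=s..<K * s. a i powr q) \<le> (\<Sum>i<s. a i powr q)"
    and tail: "d * sqrt (\<Sum>i<2 * s. (a i)\<^sup>2) \<le> (\<Sum>k=2..<K. sqrt (\<Sum>i=k * s..<k * s + s. (a i)\<^sup>2))"
  shows "d \<le> a_const q d"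
proof -
  define c where "c = a (2 * s)"
  have c: "0 < c"
  proof (rule ccontr)
    assume "\<not> 0 < c"
    then have z: "a i = 0" if "2 * s \<le> i" for i
      using antimonoD[OF anti that] nn[of i] by (simp add: c_def)
    have "(\<Sum>k=2..<K. sqrt (\<Sum>i=k * s..<k * s + s. (a i)\<^sup>2)) = 0"
    proof (rule sum.neutral, rule ballI)
      fix k assume "k \<in> {2..<K}"
      then have ks: "2 * s \<le> k * s" by (intro mult_le_mono1) simp
      have "a i = 0" if "i \<in> {k * s..<k * s + s}" for i
        using that by (intro z order.trans[OF ks]) simp
      then have "(\<Sum>i=k * s..<k * s + s. (a i)\<^sup>2) = 0"
        by simp
      then show "sqrt (\<Sum>i=k * s..<k * s + s. (a i)\<^sup>2) = 0" by simp
    qed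
    moreover have "(a 0)\<^sup>2 \<le> (\<Sum>i<2 * s. (a i)\<^sup>2)"
      using s by (intro member_le_sum) auto
    then have "0 < sqrt (\<Sum>i<2 * s. (a i)\<^sup>2)"
      using pos by (smt (verit) real_sqrt_gt_zero zero_less_power)
    ultimately show False using tail d by (simp add: mult_le_0_iff)
  qed
  show ?thesis
  proof (rule block_inequality_normalized[OF q d s K, of "\<lambda>i. a i / c"])
    show "antimono (\<lambda>i. a i / c)"
      using anti c by (auto simp: antimono_def divide_right_mono)
    show "0 \<le> a i / c" for i using nn c by simp
    show "a (2 * s) / c = 1" using c by (simp add: c_def)
    show "(\<Sum>i=s..<K * s. (a i / c) powr q) \<le> (\<Sum>i<s. (a i / c) powr q)"
      using head nn c by (simp add: powr_divide less_imp_le divide_right_mono flip: sum_divide_distrib)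
    show "d * sqrt (\<Sum>i<2 * s. (a i / c)\<^sup>2) \<le> (\<Sum>k=2..<K. sqrt (\<Sum>i=k * s..<k * s + s. (a i / c)\<^sup>2))"
      using tail c by (simp add: power_divide real_sqrt_divide divide_right_mono flip: sum_divide_distrib)
  qed
qed

section \<open>Sums of \<open>q\<close>-th powers\<close>

text \<open>On the unit interval \<open>t \<le> t powr q\<close>; this is applied to
  \<open>x / (x + y)\<close> and \<open>y / (x + y)\<close>, whose sum is 1.\<close>

lemma powr_add_le:
  fixes x y q :: real
  assumes "0 < q" "q \<le> 1" "0 \<le> x" "0 \<le> y"
  shows "(x + y) powr q \<le> x powr q + y powr q"
proof (cases "x + y = 0")
  case False
  then have p: "0 < x + y" using assms by linarith
  have "t / (x + y) \<le> (t / (x + y)) powr q" if "0 \<le> t" "t \<le> x + y" for t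
    using powr_mono'[of q 1 "t / (x + y)"] assms p that by (simp add: divide_le_eq)
  from this[of x] this[of y] have "x / (x + y) + y / (x + y) \<le> (x powr q + y powr q) / (x + y) powr q"
    using assms p by (simp add: powr_divide add_divide_distrib)
  then show ?thesis
    using p by (simp add: le_divide_eq flip: add_divide_distrib)
qed (use assms in simp)

text \<open>The outer root is left out because for \<open>q \<le> 1\<close> the sum itself satisfies
  the triangle inequality, while \<open>lq_norm\<close> is in general only a quasi-norm.\<close>

definition lq_sum :: "real \<Rightarrow> 'n set \<Rightarrow> real ^ 'n \<Rightarrow> real" where
  "lq_sum q S v = (\<Sum>i\<in>S. \<bar>v $ i\<bar> powr q)"

lemma lq_sum_nonneg: "0 \<le> lq_sum q S v"
  by (simp add: lq_sum_def sum_nonneg)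

lemma lq_sum_compl: "lq_sum q S v + lq_sum q (- S) v = lq_sum q UNIV v"
  using sum.subset_diff[of S UNIV "\<lambda>i. \<bar>v $ i\<bar> powr q"] by (simp add: lq_sum_def Compl_eq_Diff_UNIV)

lemma lq_sum_mono: "S \<subseteq> T \<Longrightarrow> lq_sum q S v \<le> lq_sum q T v"
  unfolding lq_sum_def by (intro sum_mono2) auto

lemma lq_sum_minus: "lq_sum q S (- v) = lq_sum q S v"
  by (simp add: lq_sum_def)

lemma lq_sum_scale:
  "lq_sum q S (c *\<^sub>R v) = \<bar>c\<bar> powr q * lq_sum q S v"
  by (simp add: lq_sum_def abs_mult powr_mult sum_distrib_left)

lemma lq_sum_triangle:
  assumes "0 < q" "q \<le> 1"
  shows "lq_sum q S (u + v) \<le> lq_sum q S u + lq_sum q S v"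
  unfolding lq_sum_def sum.distrib[symmetric]
proof (rule sum_mono)
  fix i
  have "\<bar>(u + v) $ i\<bar> powr q \<le> (\<bar>u $ i\<bar> + \<bar>v $ i\<bar>) powr q"
    using assms by (intro powr_mono2) auto
  also have "\<dots> \<le> \<bar>u $ i\<bar> powr q + \<bar>v $ i\<bar> powr q"
    using assms by (intro powr_add_le) auto
  finally show "\<bar>(u + v) $ i\<bar> powr q \<le> \<bar>u $ i\<bar> powr q + \<bar>v $ i\<bar> powr q" .
qed

lemma lq_sum_le_norm:
  fixes v :: "real ^ 'n"
  assumes "0 < q"
  shows "lq_sum q S v \<le> CARD('n) * norm v powr q"
proof -
  have "lq_sum q S v \<le> lq_sum q UNIV v" by (intro lq_sum_mono) simp
  also have "\<dots> \<le> (\<Sum>i\<in>(UNIV::'n set). norm v powr q)"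
    unfolding lq_sum_def using assms by (intro sum_mono powr_mono2) (auto simp: component_le_norm_cart)
  finally show ?thesis by simp
qed

lemma lq_norm_powr: "0 < q \<Longrightarrow> lq_norm q v powr q = lq_sum q UNIV v"
  using lq_sum_nonneg[of q UNIV v] by (simp add: lq_norm_def lq_sum_def powr_powr)

section \<open>The strict null space property\<close>

text \<open>\<open>g j\<close> is the rank of coordinate \<open>j\<close>. The zeros that extend
  \<open>a\<close> let blocks run past \<open>CARD('n)\<close>.\<close>

lemma decreasing_rearrangement:
  fixes F :: "'n::finite \<Rightarrow> real"
  assumes "\<And>j. 0 \<le> F j"
  obtains g :: "'n \<Rightarrow> nat" and a :: "nat \<Rightarrow> real" where
    "bij_betw g UNIV {..<CARD('n)}" "antimono a" "\<And>j. a (g j) = F j"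
    "\<And>i. 0 \<le> a i" "\<And>i. CARD('n) \<le> i \<Longrightarrow> a i = 0"
proof -
  obtain xs0 :: "'n list" where xs0: "set xs0 = UNIV" "distinct xs0"
    using finite_distinct_list[of "UNIV :: 'n set"] by auto
  define xs where "xs = sort_key (\<lambda>j. - F j) xs0"
  have xs: "set xs = UNIV" "distinct xs" "sorted (map (\<lambda>j. - F j) xs)"
    using xs0 by (auto simp: xs_def)
  then have len: "length xs = CARD('n)" using distinct_card[of xs] by simp
  have b: "bij_betw ((!) xs) {..<CARD('n)} UNIV"
    using bij_betw_nth[OF xs(2) _ xs(1)[symmetric], of "{..<length xs}"] len by auto
  define a where "a i = (if i < CARD('n) then F (xs ! i) else 0)" for i
  define g where "g = the_inv_into {..<CARD('n)} ((!) xs)"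
  have g: "bij_betw g UNIV {..<CARD('n)}"
    unfolding g_def by (rule bij_betw_the_inv_into[OF b])
  show ?thesis
  proof
    show "bij_betw g UNIV {..<CARD('n)}" by fact
    show "antimono a"
    proof (rule antimonoI)
      fix i j :: nat assume "i \<le> j"
      then show "a j \<le> a i"
        using sorted_nth_mono[OF xs(3), of i j] len assms by (auto simp: a_def)
    qed
    show "a (g j) = F j" for j
      using f_the_inv_into_f_bij_betw[OF b, of j] bij_betwE[OF g] by (auto simp: a_def g_def)
    show "0 \<le> a i" for i using assms by (simp add: a_def)
    show "a i = 0" if "CARD('n) \<le> i" for i using that by (simp add: a_def)
  qed
qed

text \<open>Exchange argument: outside the common part, entries from \<open>J\<close> are at most
  \<open>a s\<close>, and the remaining initial entries are at least \<open>a s\<close> and at least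
  as many.\<close>

lemma sum_le_initial_sum:
  fixes a :: "nat \<Rightarrow> real"
  assumes anti: "antimono a" and nn: "\<And>i. 0 \<le> a i" and J: "finite J" "card J \<le> s"
  shows "sum a J \<le> sum a {..<s}"
proof -
  have "card (J - {..<s}) = card J - card (J \<inter> {..<s})"
    using J by (simp add: card_Diff_subset_Int)
  moreover have "card ({..<s} - J) = s - card (J \<inter> {..<s})"
    by (simp add: card_Diff_subset_Int Int_commute)
  ultimately have c: "card (J - {..<s}) \<le> card ({..<s} - J)" using J by simp
  have "sum a (J - {..<s}) \<le> (\<Sum>i\<in>J - {..<s}. a s)"
    by (intro sum_mono antimonoD[OF anti]) auto
  also have "\<dots> \<le> (\<Sum>i\<in>{..<s} - J. a s)"
    using c nn by (simp add: mult_right_mono)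
  also have "\<dots> \<le> sum a ({..<s} - J)"
    by (intro sum_mono antimonoD[OF anti]) auto
  finally show ?thesis
    using sum.Int_Diff[of J a "{..<s}"] sum.Int_Diff[of "{..<s}" a J] J by (simp add: Int_commute)
qed

text \<open>A violating \<open>h\<close>, ranked by size, would satisfy the hypotheses of
  \<open>block_inequality\<close>, whose conclusion contradicts \<open>ac\<close>.\<close>

lemma strict_null_space_property:
  fixes A :: "real ^ 'n ^ 'm" and q :: real
  assumes q: "0 < q" "q \<le> 1" and s: "0 < s" "2 * s \<le> CARD('n)"
    and ric: "0 < ric A (2 * s)" "ric A (2 * s) < 1"
    and ac: "a_const q (((1 - ric A (2 * s)) / (1 + ric A (2 * s))) powr (1 / 2))
              < ((1 - ric A (2 * s)) / (1 + ric A (2 * s))) powr (1 / 2)"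
    and h: "A *v h = 0" "h \<noteq> 0" and S: "card S \<le> s"
  shows "lq_sum q S h < lq_sum q (- S) h"
proof (rule ccontr)
  assume contra: "\<not> ?thesis"
  let ?n = "CARD('n)"
  define \<delta> where "\<delta> = ric A (2 * s)"
  define d where "d = ((1 - \<delta>) / (1 + \<delta>)) powr (1 / 2)"
  have d: "d = sqrt (1 - \<delta>) / sqrt (1 + \<delta>)" "0 < d"
    using ric by (auto simp: d_def \<delta>_def powr_half_sqrt real_sqrt_divide)
  have dpos: "0 < sqrt (1 + \<delta>)" using ric by (simp add: \<delta>_def)
  have rip: "(1 - \<delta>) * (norm x)\<^sup>2 \<le> (norm (A *v x))\<^sup>2"
            "(norm (A *v x))\<^sup>2 \<le> (1 + \<delta>) * (norm x)\<^sup>2" if "x \<in> sparse (2 * s)" for x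
    using rip_bound_ric[of A "2 * s"] that by (auto simp: rip_bound_def \<delta>_def)
  have lower: "sqrt (1 - \<delta>) * norm x \<le> norm (A *v x)" if "x \<in> sparse (2 * s)" for x
    using real_sqrt_le_mono[OF rip(1)[OF that]] by (simp add: real_sqrt_mult)
  have upper: "norm (A *v x) \<le> sqrt (1 + \<delta>) * norm x" if "x \<in> sparse (2 * s)" for x
    using real_sqrt_le_mono[OF rip(2)[OF that]] by (simp add: real_sqrt_mult)
  obtain g :: "'n \<Rightarrow> nat" and a where g: "bij_betw g UNIV {..<?n}" and anti: "antimono a"
    and ag: "\<And>j. a (g j) = \<bar>h $ j\<bar>" and nn: "\<And>i. 0 \<le> a i" and a0: "\<And>i. ?n \<le> i \<Longrightarrow> a i = 0"
    using decreasing_rearrangement[of "\<lambda>j. \<bar>h $ j\<bar>"] by auto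
  have g_less: "g j < ?n" for j using bij_betwE[OF g] by auto
  have inj: "inj g" using g by (simp add: bij_betw_def)
  define R where "R I = (\<chi> j. if g j \<in> I then h $ j else 0)" for I
  have norm_R: "norm (R I) = sqrt (\<Sum>i\<in>I. (a i)\<^sup>2)" if "finite I" for I
  proof -
    have "(\<Sum>j\<in>UNIV. (R I $ j)\<^sup>2) = (\<Sum>j\<in>UNIV. if g j \<in> I then (a (g j))\<^sup>2 else 0)"
      by (intro sum.cong) (auto simp: R_def ag)
    also have "\<dots> = (\<Sum>i<?n. if i \<in> I then (a i)\<^sup>2 else 0)"
      by (rule sum.reindex_bij_betw[OF g])
    also have "\<dots> = (\<Sum>i\<in>{..<?n} \<inter> I. (a i)\<^sup>2)"
      by (simp add: sum.inter_restrict)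
    also have "\<dots> = (\<Sum>i\<in>I. (a i)\<^sup>2)"
      using that a0 by (intro sum.mono_neutral_left) (auto simp flip: not_le)
    finally show ?thesis by (simp add: norm_vec_def L2_set_def)
  qed
  have sparse_R: "R I \<in> sparse k" if "finite I" "card I \<le> k" for I k
  proof -
    have "card {j. R I $ j \<noteq> 0} = card (g ` {j. R I $ j \<noteq> 0})"
      using inj by (simp add: card_image inj_on_subset)
    also have "\<dots> \<le> card I" using that by (intro card_mono) (auto simp: R_def)
    finally show ?thesis using that by (simp add: sparse_def)
  qed
  have R_Un: "R (I \<union> J) = R I + R J" if "I \<inter> J = {}" for I J
    using that by (auto simp: R_def vec_eq_iff)
  have R_add: "R {i..<k} = R {i..<j} + R {j..<k}" if "i \<le> j" "j \<le> k" for i j k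
    using R_Un[of "{i..<j}" "{j..<k}"] that by (simp add: ivl_disj_un)
  \<comment> \<open>The upper isometry bound applies to sparse vectors only, so the image of the
    tail is estimated block by block.\<close>
  have tail_le: "norm (A *v R {2 * s..<K * s}) \<le> sqrt (1 + \<delta>) * (\<Sum>k=2..<K. norm (R {k * s..<k * s + s}))"
    if "2 \<le> K" for K
    using that
  proof (induction K rule: dec_induct)
    case base
    have "R {2 * s..<2 * s} = 0" by (simp add: R_def vec_eq_iff)
    then show ?case by simp
  next
    case (step K)
    have "R {2 * s..<Suc K * s} = R {2 * s..<K * s} + R {K * s..<K * s + s}"
      using R_add[of "2 * s" "K * s" "K * s + s"] step by (simp add: add.commute)
    then have "norm (A *v R {2 * s..<Suc K * s}) \<le> norm (A *v R {2 * s..<K * s}) + norm (A *v R {K * s..<K * s + s})"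
      by (simp add: matrix_vector_right_distrib norm_triangle_ineq)
    also have "norm (A *v R {K * s..<K * s + s}) \<le> sqrt (1 + \<delta>) * norm (R {K * s..<K * s + s})"
      by (intro upper sparse_R) auto
    finally show ?case using step by (simp add: algebra_simps)
  qed
  have n2: "2 \<le> ?n" using s by linarith
  \<comment> \<open>\<open>CARD('n)\<close> blocks of length \<open>s\<close> cover all ranks;
    surplus ranks carry zeros.\<close>
  have nle: "?n \<le> ?n * s" using s by simp
  have "g j < ?n * s" for j using order.strict_trans2[OF g_less nle] .
  then have "h = R {0..<?n * s}"
    by (simp add: R_def vec_eq_iff)
  also have "\<dots> = R {0..<2 * s} + R {2 * s..<?n * s}"
    using n2 by (intro R_add) auto
  finally have split: "h = R {0..<2 * s} + R {2 * s..<?n * s}" .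
  \<comment> \<open>Head and tail have opposite images, so the lower isometry bound for the head
    meets the upper bounds for the tail blocks; the quotient of the two constants is
    \<open>d\<close>.\<close>
  have "A *v R {0..<2 * s} + A *v R {2 * s..<?n * s} = 0"
    unfolding matrix_vector_right_distrib[symmetric] split[symmetric] by (rule h)
  then have "A *v R {0..<2 * s} = - (A *v R {2 * s..<?n * s})"
    by (rule eq_neg_iff_add_eq_0[THEN iffD2])
  moreover have "sqrt (1 - \<delta>) * norm (R {0..<2 * s}) \<le> norm (A *v R {0..<2 * s})"
    by (intro lower sparse_R) auto
  ultimately have "sqrt (1 - \<delta>) * norm (R {0..<2 * s})
      \<le> sqrt (1 + \<delta>) * (\<Sum>k=2..<?n. norm (R {k * s..<k * s + s}))"
    using tail_le[OF n2] by simp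
  then have "d * norm (R {0..<2 * s}) \<le> (\<Sum>k=2..<?n. norm (R {k * s..<k * s + s}))"
    using dpos by (simp add: d field_simps)
  then have tail: "d * sqrt (\<Sum>i<2 * s. (a i)\<^sup>2) \<le> (\<Sum>k=2..<?n. sqrt (\<Sum>i=k * s..<k * s + s. (a i)\<^sup>2))"
    by (simp add: norm_R lessThan_atLeast0)
  have lq: "lq_sum q J h = (\<Sum>i\<in>g ` J. a i powr q)" for J
    using inj_on_subset[OF inj, of J] by (simp add: lq_sum_def sum.reindex ag)
  have anti_q: "antimono (\<lambda>i. a i powr q)"
    using anti nn q by (auto simp: antimono_def intro!: powr_mono2)
  have "lq_sum q S h \<le> (\<Sum>i<s. a i powr q)"
    unfolding lq using anti_q S inj
    by (intro sum_le_initial_sum) (auto simp: card_image inj_on_subset)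
  moreover have "lq_sum q UNIV h = (\<Sum>i<s. a i powr q) + (\<Sum>i=s..<?n * s. a i powr q)"
  proof -
    have "lq_sum q UNIV h = (\<Sum>i<?n. a i powr q)"
      using g by (simp add: lq bij_betw_def)
    also have "\<dots> = (\<Sum>i\<in>{0..<?n * s}. a i powr q)"
      using order.strict_trans2[OF _ nle] a0 by (intro sum.mono_neutral_left) auto
    also have "\<dots> = (\<Sum>i<s. a i powr q) + (\<Sum>i=s..<?n * s. a i powr q)"
      using n2 by (simp add: sum.atLeastLessThan_concat lessThan_atLeast0)
    finally show ?thesis .
  qed
  \<comment> \<open>By \<open>contra\<close> the sum over \<open>S\<close>, hence also that over the
    first \<open>s\<close> ranks, is at least half of the total.\<close>
  ultimately have head: "(\<Sum>i=s..<?n * s. a i powr q) \<le> (\<Sum>i<s. a i powr q)"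
    using contra lq_sum_compl[of q S h] by linarith
  obtain j where "h $ j \<noteq> 0" using h by (auto simp: vec_eq_iff)
  then have "0 < a 0" using antimonoD[OF anti, of 0 "g j"] ag[of j] by simp
  from block_inequality[OF q d(2) s(1) n2 anti nn this head tail] ac
  show False by (simp add: d_def \<delta>_def)
qed

section \<open>Quantitative null space properties\<close>

text \<open>The difference on the right is continuous and positive on the compact unit sphere of the
  kernel, and \<open>c\<close> is its minimum there; homogeneity of degree \<open>q\<close> gives
  the other \<open>h\<close>.\<close>

lemma null_space_gap:
  fixes A :: "real ^ 'n ^ 'm" and q :: real
  assumes q: "0 < q"
    and nsp: "\<And>h. A *v h = 0 \<Longrightarrow> h \<noteq> 0 \<Longrightarrow> lq_sum q S h < lq_sum q (- S) h"
  shows "\<exists>c>0. \<forall>h. A *v h = 0 \<longrightarrow> c * norm h powr q \<le> lq_sum q (- S) h - lq_sum q S h"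
proof -
  define \<phi> where "\<phi> h = lq_sum q (- S) h - lq_sum q S h" for h
  define K where "K = {h. A *v h = 0} \<inter> sphere 0 1"
  have "closed {h. A *v h = 0}"
    by (intro closed_Collect_eq continuous_intros linear_continuous_on matrix_vector_mul_bounded_linear)
  then have K: "compact K" unfolding K_def by (intro closed_Int_compact) auto
  have cont: "continuous_on K \<phi>"
    unfolding \<phi>_def lq_sum_def using q by (intro continuous_intros continuous_on_powr') auto
  show ?thesis
  proof (cases "K = {}")
    case True
    have zero: "h = 0" if "A *v h = 0" for h
    proof (rule ccontr)
      assume "h \<noteq> 0"
      then have "(1 / norm h) *\<^sub>R h \<in> K"
        using that by (simp add: K_def matrix_vector_mult_scaleR)
      with True show False by simp
    qed
    have "1 * norm h powr q \<le> lq_sum q (- S) h - lq_sum q S h" if "A *v h = 0" for h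
      using zero[OF that] by (simp add: lq_sum_def)
    then show ?thesis by (intro exI[of _ 1]) simp
  next
    case False
    then obtain k where k: "k \<in> K" "\<And>h. h \<in> K \<Longrightarrow> \<phi> k \<le> \<phi> h"
      using continuous_attains_inf[OF K _ cont] by blast
    have "A *v k = 0" "k \<noteq> 0" using k(1) by (auto simp: K_def)
    then have "0 < \<phi> k" using nsp[of k] by (simp add: \<phi>_def)
    moreover have "\<phi> k * norm h powr q \<le> \<phi> h" if "A *v h = 0" for h
    proof (cases "h = 0")
      case False
      then have "(1 / norm h) *\<^sub>R h \<in> K"
        using that by (simp add: K_def matrix_vector_mult_scaleR)
      then have "\<phi> k \<le> \<phi> ((1 / norm h) *\<^sub>R h)" by (rule k)
      also have "\<dots> = \<phi> h / norm h powr q"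
        by (simp add: \<phi>_def lq_sum_scale powr_divide diff_divide_distrib)
      finally show ?thesis using False by (simp add: field_simps)
    qed (simp add: \<phi>_def lq_sum_def)
    ultimately show ?thesis unfolding \<phi>_def by (intro exI[of _ "\<phi> k"]) (simp add: \<phi>_def)
  qed
qed

text \<open>\<open>h\<close> is split into a kernel vector \<open>v\<close> and a remainder
  \<open>u\<close> whose norm is controlled by that of \<open>A *v h\<close>; the gap for
  \<open>v\<close> is transferred to \<open>h\<close>.\<close>

lemma robust_null_space_gap:
  fixes A :: "real ^ 'n ^ 'm" and q :: real
  assumes q: "0 < q" "q \<le> 1"
    and nsp: "\<And>h. A *v h = 0 \<Longrightarrow> h \<noteq> 0 \<Longrightarrow> lq_sum q S h < lq_sum q (- S) h"
  shows "\<exists>c>0. \<exists>E>0. \<forall>h. c * norm h powr q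
    \<le> lq_sum q (- S) h - lq_sum q S h + E * norm (A *v h) powr q"
proof -
  obtain c where c: "0 < c"
    "\<And>h. A *v h = 0 \<Longrightarrow> c * norm h powr q \<le> lq_sum q (- S) h - lq_sum q S h"
    using null_space_gap[OF q(1) nsp] by blast
  \<comment> \<open>\<open>A\<close> need not be onto: \<open>g\<close> inverts it on its range,
    which contains \<open>A *v h\<close>.\<close>
  obtain g :: "real ^ 'm \<Rightarrow> real ^ 'n" where g: "linear g" "\<And>v. A *v g (A *v v) = A *v v"
    using linear_exists_right_inverse_on[OF matrix_vector_mul_linear[of A] subspace_UNIV] by auto
  obtain B where B: "0 < B" "\<And>v. norm (g v) \<le> B * norm v"
    using linear_bounded_pos[OF g(1)] by blast
  \<comment> \<open>\<open>c\<close> pays for passing from \<open>norm v\<close> to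
    \<open>norm h\<close>, and \<open>CARD('n)\<close> for the sums of \<open>u\<close> over
    \<open>S\<close> and its complement.\<close>
  define E where "E = c + CARD('n)"
  have E: "0 < E" using c by (simp add: E_def add_pos_nonneg)
  have main: "c * norm h powr q \<le> lq_sum q (- S) h - lq_sum q S h + E * B powr q * norm (A *v h) powr q" for h
  proof -
    define u where "u = g (A *v h)"
    define v where "v = h - u"
    have h: "h = v + u" by (simp add: v_def)
    have "A *v v = 0" by (simp add: v_def u_def g matrix_vector_mult_diff_distrib)
    then have "c * norm v powr q \<le> lq_sum q (- S) v - lq_sum q S v" by (rule c)
    moreover have "lq_sum q (- S) v \<le> lq_sum q (- S) h + lq_sum q (- S) u"
      using lq_sum_triangle[OF q, of "- S" h "- u"] by (simp add: v_def lq_sum_minus)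
    moreover have "lq_sum q S h \<le> lq_sum q S v + lq_sum q S u"
      using lq_sum_triangle[OF q, of S v u] h by simp
    moreover have "lq_sum q S u + lq_sum q (- S) u \<le> CARD('n) * norm u powr q"
      using lq_sum_le_norm[OF q(1), of UNIV u] by (simp add: lq_sum_compl)
    moreover have "c * norm h powr q \<le> c * (norm v powr q + norm u powr q)"
    proof (intro mult_left_mono)
      have "norm h powr q \<le> (norm v + norm u) powr q"
        using h norm_triangle_ineq[of v u] q by (intro powr_mono2) auto
      also have "\<dots> \<le> norm v powr q + norm u powr q"
        using q by (intro powr_add_le) auto
      finally show "norm h powr q \<le> norm v powr q + norm u powr q" .
    qed (use c in simp)
    moreover have "E * norm u powr q \<le> E * (B powr q * norm (A *v h) powr q)"
    proof (intro mult_left_mono)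
      have "norm u powr q \<le> (B * norm (A *v h)) powr q"
        unfolding u_def using B q by (intro powr_mono2) auto
      also have "\<dots> = B powr q * norm (A *v h) powr q"
        by (rule powr_mult)
      finally show "norm u powr q \<le> B powr q * norm (A *v h) powr q" .
    qed (use E in simp)
    ultimately show ?thesis by (simp add: E_def algebra_simps)
  qed
  have "0 < E * B powr q" using E B by simp
  with main c(1) show ?thesis by blast
qed

text \<open>\<open>h\<close> stands for the recovery error and \<open>\<sigma>\<close> for the
  sparse approximation error. Both \<open>\<sigma> powr q\<close> and
  \<open>\<epsilon> powr q\<close> are at most \<open>(\<sigma> + \<epsilon>) powr q\<close>, after
  which a \<open>q\<close>-th root is taken.\<close>

lemma recovery_bound:
  fixes A :: "real ^ 'n ^ 'm" and q :: real
  assumes q: "0 < q" "q \<le> 1"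
    and nsp: "\<And>h. A *v h = 0 \<Longrightarrow> h \<noteq> 0 \<Longrightarrow> lq_sum q S h < lq_sum q (- S) h"
  shows "\<exists>D>0. \<forall>h \<sigma> \<epsilon>. 0 \<le> \<sigma> \<longrightarrow> 0 \<le> \<epsilon> \<longrightarrow> lq_sum q (- S) h - lq_sum q S h \<le> 2 * \<sigma> powr q \<longrightarrow>
    norm (A *v h) \<le> 2 * \<epsilon> \<longrightarrow> norm h \<le> D * (\<sigma> + \<epsilon>)"
proof -
  obtain c E where c: "0 < c" and E: "0 < E"
    and gap: "\<And>h. c * norm h powr q \<le> lq_sum q (- S) h - lq_sum q S h + E * norm (A *v h) powr q"
    using robust_null_space_gap[OF q nsp] by blast
  define D where "D = ((2 + 2 * E) / c) powr (1 / q)"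
  have D: "0 < D" "D powr q = (2 + 2 * E) / c"
    using c E q by (simp_all add: D_def powr_powr)
  have "norm h \<le> D * (\<sigma> + \<epsilon>)"
    if nn: "0 \<le> \<sigma>" "0 \<le> \<epsilon>" and gap_le: "lq_sum q (- S) h - lq_sum q S h \<le> 2 * \<sigma> powr q"
      and Ah: "norm (A *v h) \<le> 2 * \<epsilon>" for h \<sigma> \<epsilon>
  proof -
    have "norm (A *v h) powr q \<le> (\<epsilon> + \<epsilon>) powr q"
      using Ah q by (intro powr_mono2) auto
    also have "\<dots> \<le> 2 * \<epsilon> powr q"
      using powr_add_le[OF q nn(2) nn(2)] by simp
    also have "\<dots> \<le> 2 * (\<sigma> + \<epsilon>) powr q"
      using nn q by (simp add: powr_mono2)
    finally have "E * norm (A *v h) powr q \<le> E * (2 * (\<sigma> + \<epsilon>) powr q)"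
      using E by (intro mult_left_mono) auto
    moreover have "\<sigma> powr q \<le> (\<sigma> + \<epsilon>) powr q"
      using nn q by (intro powr_mono2) auto
    ultimately have "c * norm h powr q \<le> (2 + 2 * E) * (\<sigma> + \<epsilon>) powr q"
      using gap[of h] gap_le by (simp add: algebra_simps)
    then have "norm h powr q \<le> D powr q * (\<sigma> + \<epsilon>) powr q"
      unfolding D(2) using c by (simp add: pos_le_divide_eq mult.commute)
    then have "norm h powr q \<le> (D * (\<sigma> + \<epsilon>)) powr q"
      by (simp only: powr_mult)
    moreover have "0 \<le> D * (\<sigma> + \<epsilon>)" using D nn by simp
    ultimately show ?thesis
      using powr_less_mono2[of q "D * (\<sigma> + \<epsilon>)" "norm h"] q by linarith
  qed
  with D show ?thesis by blast
qed

section \<open>From minimality to the error bounds\<close>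

text \<open>Off the support of \<open>xs\<close> the vector \<open>x\<close> agrees with
  \<open>x - xs\<close>. This part of \<open>x\<close> enters twice, once from \<open>le\<close> and
  once from the triangle inequality off the support, hence the factor 2.\<close>

lemma minimizer_cone:
  fixes x xs u :: "real ^ 'n"
  assumes q: "0 < q" "q \<le> 1" and le: "lq_norm q u \<le> lq_norm q x"
  shows "lq_sum q (- {i. xs $ i \<noteq> 0}) (u - x) - lq_sum q {i. xs $ i \<noteq> 0} (u - x)
           \<le> 2 * lq_norm q (x - xs) powr q"
proof -
  define S where "S = {i. xs $ i \<noteq> 0}"
  have "lq_norm q u powr q \<le> lq_norm q x powr q"
    using le q by (intro powr_mono2) (auto simp: lq_norm_def)
  then have "lq_sum q S u + lq_sum q (- S) u \<le> lq_sum q S x + lq_sum q (- S) x"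
    using q by (simp add: lq_norm_powr lq_sum_compl)
  moreover have "lq_sum q S x \<le> lq_sum q S u + lq_sum q S (u - x)"
    using lq_sum_triangle[OF q, of S u "- (u - x)"] lq_sum_minus[of q S "u - x"] by simp
  moreover have "lq_sum q (- S) (u - x) \<le> lq_sum q (- S) u + lq_sum q (- S) x"
    using lq_sum_triangle[OF q, of "- S" u "- x"] lq_sum_minus[of q "- S" x] by simp
  moreover have "lq_sum q (- S) x = lq_sum q (- S) (x - xs)"
    unfolding lq_sum_def S_def by (intro sum.cong) auto
  moreover have "\<dots> \<le> lq_sum q UNIV (x - xs)"
    by (intro lq_sum_mono) simp
  ultimately show ?thesis
    using q by (simp add: lq_norm_powr S_def)
qed

lemma lq_norm_le_norm:
  fixes v :: "real ^ 'n"
  assumes "0 < q"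
  shows "lq_norm q v \<le> CARD('n) powr (1 / q) * norm v"
proof -
  have "lq_norm q v = lq_sum q UNIV v powr (1 / q)"
    by (simp add: lq_norm_def lq_sum_def)
  also have "\<dots> \<le> (CARD('n) * norm v powr q) powr (1 / q)"
    using assms lq_sum_le_norm[OF assms, of UNIV v] by (intro powr_mono2) (auto simp: lq_sum_nonneg)
  also have "\<dots> = CARD('n) powr (1 / q) * norm v"
    using assms by (simp add: powr_mult powr_powr)
  finally show ?thesis .
qed

theorem theorem1p5:
  fixes A :: "real ^ 'n ^ 'm" and q :: real
  assumes "CARD('m) \<le> CARD('n)"
    and "0 < q" and "q \<le> 1"
  shows "\<exists>C0 C1 C2 C3 :: real. 0 < C0 \<and> 0 < C1 \<and> 0 < C2 \<and> 0 < C3 \<and>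
    (\<forall>s :: nat. 2 \<le> 2 * s \<and> 2 * s \<le> CARD('m) \<and>
       0 < ric A (2 * s) \<and> ric A (2 * s) < 1 \<and>
       (let \<delta>1 = ((1 - ric A (2 * s)) / (1 + ric A (2 * s))) powr (1 / 2)
        in a_const q \<delta>1 < \<delta>1) \<longrightarrow>
       (\<forall>(\<epsilon> :: real) (x :: real ^ 'n) (z :: real ^ 'm) (y :: real ^ 'm)
          (xstar :: real ^ 'n) (xs :: real ^ 'n).
          0 \<le> \<epsilon> \<and> norm z \<le> \<epsilon> \<and> y = A *v x + z \<and>
          lq_minimizer q A y \<epsilon> xstar \<and> best_sparse_approx q s x xs \<longrightarrow>
            norm (xstar - x)
              \<le> C0 * real s powr (1 / 2 - 1 / q) * lq_norm q (x - xs) + C1 * \<epsilon> \<and>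
            lq_norm q (xstar - x)
              \<le> C2 * lq_norm q (x - xs) + C3 * real s powr (1 / q - 1 / 2) * \<epsilon>))"
proof -
  note q = assms(2,3)
  \<comment> \<open>This family does not mention \<open>s\<close>, so constants built from it can be
    chosen before \<open>s\<close>.\<close>
  define \<N> where "\<N> = {S. \<forall>h. A *v h = 0 \<longrightarrow> h \<noteq> 0 \<longrightarrow> lq_sum q S h < lq_sum q (- S) h}"
  have "\<forall>S\<in>\<N>. \<exists>D>0. \<forall>h \<sigma> \<epsilon>. 0 \<le> \<sigma> \<longrightarrow> 0 \<le> \<epsilon> \<longrightarrow>
      lq_sum q (- S) h - lq_sum q S h \<le> 2 * \<sigma> powr q \<longrightarrow>
      norm (A *v h) \<le> 2 * \<epsilon> \<longrightarrow> norm h \<le> D * (\<sigma> + \<epsilon>)"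
    using recovery_bound[OF q, of A] by (auto simp: \<N>_def)
  then obtain D where D0: "\<And>S. S \<in> \<N> \<Longrightarrow> 0 < D S"
    and D: "\<And>S h \<sigma> \<epsilon>. \<lbrakk>S \<in> \<N>; 0 \<le> \<sigma>; 0 \<le> \<epsilon>; lq_sum q (- S) h - lq_sum q S h \<le> 2 * \<sigma> powr q;
      norm (A *v h) \<le> 2 * \<epsilon>\<rbrakk> \<Longrightarrow> norm h \<le> D S * (\<sigma> + \<epsilon>)"
    unfolding bchoice_iff by (metis (lifting))
  \<comment> \<open>\<open>\<N>\<close> is finite, so the sum dominates each
    \<open>D S\<close>.\<close>
  define C where "C = 1 + sum D \<N>"
  have C: "0 < C" using sum_nonneg[of \<N> D] D0 by (simp add: C_def less_imp_le add_pos_nonneg)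
  have D_le: "D S \<le> C" if "S \<in> \<N>" for S
    using member_le_sum[of S \<N> D] that D0 by (auto simp: C_def less_imp_le intro: add_increasing)
  \<comment> \<open>The exponent is nonpositive and \<open>s \<le> CARD('m)\<close>, so
    \<open>p\<close> is at most \<open>s powr (1 / 2 - 1 / q)\<close>; dividing by \<open>p\<close>
    makes that factor at least 1.\<close>
  define p where "p = CARD('m) powr (1 / 2 - 1 / q)"
  define L where "L = CARD('n) powr (1 / q)"
  have p: "0 < p" and L: "0 < L" by (simp_all add: p_def L_def)
  have key: "norm (xstar - x) \<le> C / p * real s powr (1 / 2 - 1 / q) * lq_norm q (x - xs) + C * \<epsilon> \<and>
      lq_norm q (xstar - x) \<le> (L * C) * lq_norm q (x - xs) + (L * C) * real s powr (1 / q - 1 / 2) * \<epsilon>"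
    if s: "2 \<le> 2 * s" "2 * s \<le> CARD('m)" and ric: "0 < ric A (2 * s)" "ric A (2 * s) < 1"
      and ac: "a_const q (((1 - ric A (2 * s)) / (1 + ric A (2 * s))) powr (1 / 2))
              < ((1 - ric A (2 * s)) / (1 + ric A (2 * s))) powr (1 / 2)"
      and \<epsilon>: "0 \<le> \<epsilon>" "norm z \<le> \<epsilon>" and y: "y = A *v x + z"
      and min: "lq_minimizer q A y \<epsilon> xstar" and best: "best_sparse_approx q s x xs"
    for s \<epsilon> x z y xstar xs
  proof -
    define S where "S = {i. xs $ i \<noteq> 0}"
    define \<sigma> where "\<sigma> = lq_norm q (x - xs)"
    have \<sigma>: "0 \<le> \<sigma>" by (simp add: \<sigma>_def lq_norm_def)
    have "card S \<le> s" using best by (simp add: best_sparse_approx_def sparse_def S_def)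
    then have "S \<in> \<N>"
      using strict_null_space_property[OF q _ _ ric ac] s assms(1) by (auto simp: \<N>_def)
    have feas: "norm (A *v xstar - y) \<le> \<epsilon>"
      and opt: "\<And>v. norm (A *v v - y) \<le> \<epsilon> \<Longrightarrow> lq_norm q xstar \<le> lq_norm q v"
      using min by (auto simp: lq_minimizer_def is_arg_min_linorder)
    \<comment> \<open>\<open>x\<close> is feasible, since \<open>A *v x - y = - z\<close>.\<close>
    have "lq_norm q xstar \<le> lq_norm q x"
      using \<epsilon> y by (intro opt) simp
    then have cone: "lq_sum q (- S) (xstar - x) - lq_sum q S (xstar - x) \<le> 2 * \<sigma> powr q"
      unfolding S_def \<sigma>_def by (rule minimizer_cone[OF q])
    have "A *v (xstar - x) = (A *v xstar - y) + z"
      by (simp add: y matrix_vector_mult_diff_distrib)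
    then have "norm (A *v (xstar - x)) \<le> 2 * \<epsilon>"
      using norm_triangle_ineq[of "A *v xstar - y" z] feas \<epsilon> by simp
    then have "norm (xstar - x) \<le> D S * (\<sigma> + \<epsilon>)"
      by (rule D[OF \<open>S \<in> \<N>\<close> \<sigma> \<epsilon>(1) cone])
    also have "\<dots> \<le> C * (\<sigma> + \<epsilon>)"
      using D_le[OF \<open>S \<in> \<N>\<close>] \<sigma> \<epsilon> by (intro mult_right_mono) auto
    finally have bound: "norm (xstar - x) \<le> C * (\<sigma> + \<epsilon>)" .
    have "1 / 2 \<le> 1 / q" using q by (simp add: field_simps)
    then have "p \<le> real s powr (1 / 2 - 1 / q)" and s1: "1 \<le> real s powr (1 / q - 1 / 2)"
      unfolding p_def using s by (auto intro!: powr_mono2' ge_one_powr_ge_zero)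
    then have "1 \<le> real s powr (1 / 2 - 1 / q) / p" using p by simp
    then have "C * \<sigma> * 1 \<le> C * \<sigma> * (real s powr (1 / 2 - 1 / q) / p)"
      using C \<sigma> by (intro mult_left_mono) auto
    moreover have "lq_norm q (xstar - x) \<le> L * (C * (\<sigma> + \<epsilon>))"
    proof (rule order.trans)
      show "lq_norm q (xstar - x) \<le> L * norm (xstar - x)"
        unfolding L_def by (rule lq_norm_le_norm[OF q(1)])
      show "L * norm (xstar - x) \<le> L * (C * (\<sigma> + \<epsilon>))"
        using bound L by (intro mult_left_mono) auto
    qed
    moreover have "(L * C * \<epsilon>) * 1 \<le> (L * C * \<epsilon>) * real s powr (1 / q - 1 / 2)"
      using s1 C L \<epsilon> by (intro mult_left_mono) auto
    ultimately show ?thesis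
      using bound unfolding \<sigma>_def[symmetric] by (simp add: algebra_simps)
  qed
  show ?thesis
    unfolding Let_def
    by (rule exI[of _ "C / p"], rule exI[of _ C], rule exI[of _ "L * C"], rule exI[of _ "L * C"])
      (use key C p L in auto)
qed

end
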